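(* Let $R$ be an arbitrary ring and let $S$ be a strongly $\pi$-regular subring of $R$. If $x\in S$ is invertible in $R$, then $x^{-1}\in S$.
   Context: All rings are associative with identity (not necessarily commutative), and every subring contains the identity of the larger ring. A ring $S$ is called strongly $\pi$-regular if for every $x\in S$ the descending chain of left ideals $Sx\supseteq Sx^{2}\supseteq Sx^{3}\supseteq\cdots$ stabilizes (i.e. the descending chain condition holds for the left ideals $Sx^{i}$, $i\geq 1$). *)

theory Defs
  imports "HOL-Algebra.Algebra"
begin

(* The constant PIdl (cgenideal) is by definition the set of left multiples S x, also when S is
   not commutative, so PIdl (x [^] n) is the left ideal S x^n. *)
locale strongly_pi_regular_ring = ring S for S (structure) +
  assumes left_chain_stabilizes:
    "x \<in> carrier S \<Longrightarrow>
      \<exists>n::nat. n \<ge> 1 \<and> (\<forall>m\<ge>n. PIdl (x [^] m) = PIdl (x [^] n))"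

end

theory Submission
  imports Defs
begin

text \<open>
  A stable chain of left ideals gives \<open>x\<^sup>n \<in> S x\<^sup>n = S x\<^bsup>n+1\<^esup>\<close>, say \<open>x\<^sup>n = s x\<^bsup>n+1\<^esup>\<close> with \<open>s \<in> S\<close>.
  Since \<open>x\<close> is invertible in \<open>R\<close>, the right factor \<open>x\<^sup>n\<close> can be cancelled there, which
  leaves \<open>1 = s x\<close>. As \<open>x\<close> has a two-sided inverse in \<open>R\<close>, the left inverse \<open>s\<close> must be it,
  and \<open>s\<close> was found in \<open>S\<close>.
\<close>

lemma (in monoid) inv_eq_if_pow_eq_mult_pow_Suc:
  assumes x: "x \<in> Units G" and s: "s \<in> carrier G"
    and eq: "x [^] (n::nat) = s \<otimes> x [^] Suc n"
  shows "inv x = s"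
proof -
  have xc: "x \<in> carrier G" and u: "x [^] n \<in> Units G"
    using x by (simp_all add: Units_closed Units_pow_closed)
  have "\<one> \<otimes> x [^] n = (s \<otimes> x) \<otimes> x [^] n"
    using eq xc s nat_pow_Suc2[OF xc, of n] by (simp add: m_assoc)
  then have "(\<one> \<otimes> x [^] n) \<otimes> inv (x [^] n) = ((s \<otimes> x) \<otimes> x [^] n) \<otimes> inv (x [^] n)"
    by simp
  then have "s \<otimes> x = \<one>"
    using xc s u by (simp add: m_assoc)
  then have "(s \<otimes> x) \<otimes> inv x = inv x"
    using x by simp
  then show ?thesis
    using x xc s by (simp add: m_assoc)
qed

lemma (in strongly_pi_regular_ring) pow_eq_mult_pow_Suc:
  assumes x: "x \<in> carrier S"
  obtains n :: nat and s where "s \<in> carrier S" "x [^] n = s \<otimes> x [^] Suc n"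
proof -
  obtain n :: nat where "\<forall>m\<ge>n. PIdl (x [^] m) = PIdl (x [^] n)"
    using left_chain_stabilizes[OF x] by blast
  then have "PIdl (x [^] Suc n) = PIdl (x [^] n)"
    using le_SucI[OF order_refl] by blast
  moreover have "x [^] n \<in> PIdl (x [^] n)"
    using x unfolding cgenideal_def by (auto intro!: exI[of _ \<one>])
  ultimately have "x [^] n \<in> PIdl (x [^] Suc n)"
    by simp
  then show thesis
    using that unfolding cgenideal_def by blast
qed

theorem proposition2p1:
  fixes R :: "('a, 'b) ring_scheme" and S :: "'a set" and x :: 'a
  assumes "ring R"
    and "subring S R"
    and "strongly_pi_regular_ring (R\<lparr>carrier := S\<rparr>)"
    and "x \<in> S"
    and "x \<in> Units R"
  shows "inv\<^bsub>R\<^esub> x \<in> S"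
proof -
  interpret R: ring R by fact
  interpret S: strongly_pi_regular_ring "R\<lparr>carrier := S\<rparr>" by fact
  have "x \<in> carrier (R\<lparr>carrier := S\<rparr>)"
    using \<open>x \<in> S\<close> by simp
  then obtain n :: nat and s where sc: "s \<in> carrier (R\<lparr>carrier := S\<rparr>)"
    and eq: "x [^]\<^bsub>R\<lparr>carrier := S\<rparr>\<^esub> n
      = s \<otimes>\<^bsub>R\<lparr>carrier := S\<rparr>\<^esub> x [^]\<^bsub>R\<lparr>carrier := S\<rparr>\<^esub> Suc n"
    by (rule S.pow_eq_mult_pow_Suc)
  from sc have s: "s \<in> S"
    by simp
  have "x [^]\<^bsub>R\<^esub> n = s \<otimes>\<^bsub>R\<^esub> x [^]\<^bsub>R\<^esub> Suc n"
    using eq unfolding R.nat_pow_consistent[of x _ S, symmetric] by simp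
  moreover have "s \<in> carrier R"
    using s subringE(1)[OF \<open>subring S R\<close>] by blast
  ultimately have "inv\<^bsub>R\<^esub> x = s"
    using \<open>x \<in> Units R\<close> by (intro R.inv_eq_if_pow_eq_mult_pow_Suc)
  with s show ?thesis
    by simp
qed

end
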